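(* Consider the problems $$(R):\ \min_{Z\in\mathbb R^{m\times n},\,\mathrm{rank}(Z)\le d}\tfrac12f(Z)+\lambda\,\mathrm{rank}(Z),$$ $$(U):\ \min_{(X,Y)\in\mathbb R^{m\times d}\times\mathbb R^{n\times d}}F_0(X,Y),\qquad (B):\ \min_{(X,Y)\in\Omega^1\times\Omega^2}F_0(X,Y),$$ where $F_0(X,Y):=f(XY^{\mathbb T})+\lambda(\mathrm{nnzc}(X)+\mathrm{nnzc}(Y))$. Let $\mathcal G_{R},\mathcal G_{U},\mathcal G_{B}$ be their sets of global minimizers, and let $\mathcal G_R^\star:=\{Z\in\mathcal G_R:\|Z\|\le\varsigma^2\}$. Then: (i) $\{XY^{\mathbb T}:(X,Y)\in\mathcal G_U\}=\mathcal G_R$. (ii) If $Z^\star\in\mathcal G_R^\star$, then there exists $(X^\star,Y^\star)\in\mathcal G_U$ such that $X^\star{Y^\star}^{\mathbb T}=Z^\star$ and $(X^\star,Y^\star)\in\Omega^1\times\Omega^2$. (iii) If $\mathcal G_R^\star\ne\emptyset$, then $\mathcal G_B\subseteq\mathcal G_U$ and $\mathcal G_R^\star\subseteq\{XY^{\mathbb T}:(X,Y)\in\mathcal G_B\}\subseteq\mathcal G_R$. Further, $\{XY^{\mathbb T}:(X,Y)\in\mathcal G_B\}=\mathcal G_R$ when $\mathcal G_R^\star=\mathcal G_R$.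
   Context: Let $m\ge n\ge1$ and $d\ge1$ be integers, $\lambda>0$, $\varsigma>0$, and let $f:\mathbb R^{m\times n}\to\mathbb R$ be locally Lipschitz continuous. $\|\cdot\|$ is the Euclidean norm of vectors and the spectral norm of matrices. For a matrix $C$ with $d$ columns, $C_i$ is its $i$-th column and $\mathrm{nnzc}(C)$ is its number of nonzero columns. $\Omega^1:=\{X\in\mathbb R^{m\times d}:\|X_i\|\le\varsigma,\ i=1,\dots,d\}$ and $\Omega^2:=\{Y\in\mathbb R^{n\times d}:\|Y_i\|\le\varsigma,\ i=1,\dots,d\}$. *)

theory Defs
  imports "HOL-Analysis.Analysis"
begin

(* Dimensions are index types: m = CARD('m), n = CARD('n), d = CARD('d), so a matrix in
   R^(m x n) has type real^'n^'m.  The type class norm on matrices is the Frobenius norm;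
   the spectral norm is therefore defined separately.  On column vectors, norm is Euclidean. *)

definition spectral_norm :: "real^'n^'m \<Rightarrow> real" where
  "spectral_norm Z = onorm (\<lambda>v. Z *v v)"

definition nnzc :: "real^'d^'k \<Rightarrow> nat" where
  "nnzc C = card {i. column i C \<noteq> 0}"

(* With 'k = 'm this is Omega^1, with 'k = 'n it is Omega^2. *)
definition Omega :: "real \<Rightarrow> (real^'d^'k) set" where
  "Omega \<sigma> = {C. \<forall>i. norm (column i C) \<le> \<sigma>}"

(* Uses only distances, and all norms on matrices are equivalent, so it does not matter
   that dist comes from the Frobenius norm. *)
definition locally_lipschitz :: "('a::metric_space \<Rightarrow> 'b::metric_space) \<Rightarrow> bool" where
  "locally_lipschitz f \<longleftrightarrow> (\<forall>x. \<exists>u>0. \<exists>L. L-lipschitz_on (cball x u) f)"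

definition global_minimizers :: "'a set \<Rightarrow> ('a \<Rightarrow> real) \<Rightarrow> 'a set" where
  "global_minimizers S g = {x. is_arg_min g (\<lambda>y. y \<in> S) x}"

definition factor_prod :: "((real^'d^'m) \<times> (real^'d^'n)) \<Rightarrow> real^'n^'m" where
  "factor_prod = (\<lambda>(X, Y). X ** transpose Y)"

definition F0 :: "(real^'n^'m \<Rightarrow> real) \<Rightarrow> real \<Rightarrow> ((real^'d^'m) \<times> (real^'d^'n)) \<Rightarrow> real" where
  "F0 f lam = (\<lambda>(X, Y). f (X ** transpose Y) + lam * (real (nnzc X) + real (nnzc Y)))"

definition G_R :: "(real^'n^'m \<Rightarrow> real) \<Rightarrow> real \<Rightarrow> nat \<Rightarrow> (real^'n^'m) set" where
  "G_R f lam d = global_minimizers {Z. rank Z \<le> d} (\<lambda>Z. 1/2 * f Z + lam * real (rank Z))"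

definition G_R_star :: "(real^'n^'m \<Rightarrow> real) \<Rightarrow> real \<Rightarrow> real \<Rightarrow> nat \<Rightarrow> (real^'n^'m) set" where
  "G_R_star f lam \<sigma> d = {Z \<in> G_R f lam d. spectral_norm Z \<le> \<sigma>\<^sup>2}"

definition G_U :: "(real^'n^'m \<Rightarrow> real) \<Rightarrow> real \<Rightarrow> ((real^'d^'m) \<times> (real^'d^'n)) set" where
  "G_U f lam = global_minimizers UNIV (F0 f lam)"

definition G_B :: "(real^'n^'m \<Rightarrow> real) \<Rightarrow> real \<Rightarrow> real \<Rightarrow> ((real^'d^'m) \<times> (real^'d^'n)) set" where
  "G_B f lam \<sigma> = global_minimizers (Omega \<sigma> \<times> Omega \<sigma>) (F0 f lam)"

end

theory Submission
  imports Defs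
begin

text \<open>
  The rank problem and the factorized problems correspond via \<open>Z = X ** transpose Y\<close> because
  \<open>2 * rank Z\<close> is the least value of \<open>nnzc X + nnzc Y\<close> over all factorizations
  \<open>Z = X ** transpose Y\<close> with \<open>CARD('d) \<ge> rank Z\<close> columns. Minimizing \<open>F0\<close> over the
  factorizations of a fixed \<open>Z\<close> therefore leaves twice the objective of the rank problem.

  No factorization does better, since the rank of a product is at most the rank of either factor,
  which is at most its number of nonzero columns (\<open>rank_le_nnzc\<close>). The bound is attained
  (\<open>rank_factorization\<close>): for an orthonormal basis \<open>v\<^sub>1, \<dots>, v\<^sub>r\<close> of the row space of \<open>Z\<close>,
  every row is the sum of its projections onto the \<open>v\<^sub>k\<close>, so \<open>Z\<close> is the sum of the dyads
  \<open>(Z v\<^sub>k) v\<^sub>k\<^sup>T\<close>. Moving a factor \<open>c > 0\<close> from one side to the other, the columns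
  \<open>(1/c) Z v\<^sub>k\<close> and \<open>c v\<^sub>k\<close> have norms at most \<open>\<parallel>Z\<parallel> / c\<close> and \<open>c\<close>. With \<open>c = \<sigma>\<close>
  both are at most \<open>\<sigma>\<close> as soon as \<open>\<parallel>Z\<parallel> \<le> \<sigma>\<^sup>2\<close>, where \<open>\<parallel>Z\<parallel>\<close> is the spectral norm.

  The rest holds for arbitrary minimization problems. A minimizer passes between a problem and its
  lift when the objective of the lift has the original objective as its attained lower bound on
  every fibre (\<open>image_global_minimizers_lift\<close>). Shrinking the feasible set while retaining at
  least one minimizer cuts the set of minimizers down to the smaller feasible set
  (\<open>global_minimizers_restrict\<close>). A minimizer \<open>Z\<close> of the rank problem with
  \<open>\<parallel>Z\<parallel> \<le> \<sigma>\<^sup>2\<close> provides such a retained minimizer, its bounded factorization, and so the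
  bounded problem has exactly the minimizers of the unbounded one that obey the column bounds.
\<close>

section \<open>Minimizers of lifted and of restricted problems\<close>

lemma mem_global_minimizers_iff:
  "x \<in> global_minimizers S g \<longleftrightarrow> x \<in> S \<and> (\<forall>y\<in>S. g x \<le> g y)"
  by (auto simp: global_minimizers_def is_arg_min_linorder)

lemma image_global_minimizers_lift:
  assumes maps: "p ` A \<subseteq> S"
    and lower: "\<And>x. x \<in> A \<Longrightarrow> g (p x) \<le> F x"
    and attained: "\<And>z. z \<in> S \<Longrightarrow> \<exists>x\<in>A. p x = z \<and> F x \<le> g z"
  shows "p ` global_minimizers A F = global_minimizers S g"
proof
  show "p ` global_minimizers A F \<subseteq> global_minimizers S g"
  proof
    fix z assume "z \<in> p ` global_minimizers A F"
    then obtain x where x: "x \<in> A" "\<And>y. y \<in> A \<Longrightarrow> F x \<le> F y" and z: "z = p x"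
      by (auto simp: mem_global_minimizers_iff)
    have "g z \<le> g w" if "w \<in> S" for w
      using lower[OF x(1)] attained[OF that] x(2) z by fastforce
    then show "z \<in> global_minimizers S g"
      using maps x(1) z by (auto simp: mem_global_minimizers_iff)
  qed
next
  show "global_minimizers S g \<subseteq> p ` global_minimizers A F"
  proof
    fix z assume z: "z \<in> global_minimizers S g"
    then obtain x where x: "x \<in> A" "p x = z" "F x \<le> g z"
      using attained by (auto simp: mem_global_minimizers_iff)
    have "F x \<le> F y" if "y \<in> A" for y
    proof -
      have "g z \<le> g (p y)"
        using z maps that by (auto simp: mem_global_minimizers_iff)
      then show ?thesis
        using x(3) lower[OF that] by linarith
    qed
    then show "z \<in> p ` global_minimizers A F"
      using x by (auto simp: mem_global_minimizers_iff)
  qed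
qed

text \<open>
  The minimum of \<open>g\<close> bounds \<open>F\<close> from below on all of \<open>A\<close>, so every feasible point where
  \<open>F\<close> does not exceed it is a minimizer. This locates a prescribed point of the fibre, such as a
  bounded factorization, where the equality of images only gives some point of the fibre.
\<close>

lemma global_minimizers_lift_fibre:
  assumes maps: "p ` A \<subseteq> S"
    and lower: "\<And>x. x \<in> A \<Longrightarrow> g (p x) \<le> F x"
    and "p x \<in> global_minimizers S g" "x \<in> A" "F x \<le> g (p x)"
  shows "x \<in> global_minimizers A F"
proof -
  have "F x \<le> F y" if "y \<in> A" for y
  proof -
    have "g (p x) \<le> g (p y)"
      using assms(3) maps that by (auto simp: mem_global_minimizers_iff)
    then show ?thesis
      using assms(5) lower[OF that] by linarith
  qed
  then show ?thesis
    using assms(4) by (simp add: mem_global_minimizers_iff)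
qed

lemma global_minimizers_restrict:
  assumes "B \<subseteq> A" "global_minimizers A F \<inter> B \<noteq> {}"
  shows "global_minimizers B F = global_minimizers A F \<inter> B"
proof -
  obtain x0 where "x0 \<in> global_minimizers A F" "x0 \<in> B"
    using assms(2) by blast
  then have x0: "x0 \<in> B" "\<And>y. y \<in> A \<Longrightarrow> F x0 \<le> F y"
    by (simp_all add: mem_global_minimizers_iff)
  show ?thesis
    unfolding set_eq_iff Int_iff mem_global_minimizers_iff
    using x0 assms(1) by (meson order_trans subsetD)
qed

section \<open>Rank and the number of nonzero columns\<close>

text \<open>The nonzero columns alone span the column space.\<close>

lemma rank_le_nnzc: "rank C \<le> nnzc C"
  for C :: "real^'d^'k"
proof -
  have "columns C \<subseteq> span ((\<lambda>i. column i C) ` {i. column i C \<noteq> 0})"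
  proof
    fix x assume "x \<in> columns C"
    then obtain i where i: "x = column i C"
      by (auto simp: columns_def)
    show "x \<in> span ((\<lambda>i. column i C) ` {i. column i C \<noteq> 0})"
    proof (cases "x = 0")
      case False
      then show ?thesis
        using i by (intro span_base) auto
    qed (simp add: span_zero)
  qed
  then have "dim (columns C) \<le> card ((\<lambda>i. column i C) ` {i. column i C \<noteq> 0})"
    by (intro dim_le_card) auto
  also have "\<dots> \<le> nnzc C"
    unfolding nnzc_def by (rule card_image_le) simp
  finally show ?thesis
    by (simp add: column_rank_def)
qed

lemma rank_factor_prod_le_nnzc:
  fixes X :: "real^'d^'m" and Y :: "real^'d^'n"
  shows "rank (X ** transpose Y) \<le> nnzc X" "rank (X ** transpose Y) \<le> nnzc Y"
proof -
  show "rank (X ** transpose Y) \<le> nnzc X"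
    using rank_mul_le_left[of X "transpose Y"] rank_le_nnzc[of X] by linarith
  show "rank (X ** transpose Y) \<le> nnzc Y"
    using rank_mul_le_right[of X "transpose Y"] rank_le_nnzc[of Y]
    by (simp add: rank_transpose)
qed

lemma nnzc_le_CARD: "nnzc (C :: real^'d^'k) \<le> CARD('d)"
  unfolding nnzc_def by (intro card_mono) auto

section \<open>Rank factorizations with bounded columns\<close>

lemma norm_matrix_vector_mult_le_spectral_norm:
  "norm (Z *v v) \<le> spectral_norm Z * norm v"
  unfolding spectral_norm_def
  using onorm[OF matrix_vector_mul_bounded_linear] .

text \<open>
  An orthonormal basis of the row space, padded with zero vectors so that all of \<open>'d\<close> serves as
  index type. The vectors \<open>h k\<close> with \<open>k \<in> I\<close> form the basis, and padding does not affect the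
  expansion of vectors in the row space.
\<close>

lemma row_space_padded_orthonormal_basis:
  fixes Z :: "real^'n^'m"
  assumes "rank Z \<le> CARD('d::finite)"
  obtains I :: "('d::finite) set" and h :: "('d::finite) \<Rightarrow> real^'n"
  where "card I = rank Z" "\<And>k. k \<notin> I \<Longrightarrow> h k = 0" "\<And>k. norm (h k) \<le> 1"
    "\<And>i. (\<Sum>k\<in>UNIV. (Z $ i \<bullet> h k) *\<^sub>R h k) = Z $ i"
proof -
  obtain B where B: "pairwise orthogonal B" "\<And>x. x \<in> B \<Longrightarrow> norm x = 1" "independent B"
      "card B = dim (span (rows Z))" "span B = span (rows Z)"
    using orthonormal_basis_subspace[OF subspace_span[of "rows Z"]] by (metis span_span)
  have fin: "finite B"
    using B(3) by (rule independent_imp_finite)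
  have cardB: "card B = rank Z"
    using B(4) by (simp add: row_rank_def)
  obtain I :: "'d set" where I: "card I = rank Z"
    using obtain_subset_with_card_n[OF assms] by blast
  obtain b where b: "bij_betw b I B"
    using finite_same_card_bij[of I B] fin I cardB by auto
  define h where "h k = (if k \<in> I then b k else 0)" for k
  have expand: "(\<Sum>k\<in>UNIV. (Z $ i \<bullet> h k) *\<^sub>R h k) = Z $ i" for i
  proof -
    have "Z $ i \<in> span B"
      unfolding B(5) by (rule span_base) (auto simp: rows_def row_def)
    have "(\<Sum>k\<in>UNIV. (Z $ i \<bullet> h k) *\<^sub>R h k) = (\<Sum>k\<in>I. (Z $ i \<bullet> b k) *\<^sub>R b k)"
      by (rule sum.mono_neutral_cong_right) (auto simp: h_def)
    also have "\<dots> = (\<Sum>v\<in>B. (Z $ i \<bullet> v) *\<^sub>R v)"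
      by (rule sum.reindex_bij_betw[OF b])
    also have "\<dots> = Z $ i"
      using orthonormal_basis_expand B(1,2) \<open>Z $ i \<in> span B\<close> fin by blast
    finally show ?thesis .
  qed
  have "norm (h k) \<le> 1" for k
    using bij_betwE[OF b] B(2) by (simp add: h_def)
  moreover have "h k = 0" if "k \<notin> I" for k
    using that by (simp add: h_def)
  ultimately show thesis
    using that I expand by blast
qed

text \<open>
  The row expansion \<open>Z $ i = (\<Sum>k. (Z *v h k) $ i *\<^sub>R h k)\<close> is a factorization of \<open>Z\<close> through
  the columns \<open>Z *v h k\<close> and \<open>h k\<close>. The scaling by \<open>c\<close> distributes the size of \<open>Z\<close> between
  the two factors.
\<close>

lemma rank_factorization:
  fixes Z :: "real^'n^'m"
  assumes "rank Z \<le> CARD('d::finite)" "c > 0"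
  obtains X :: "real^'d^'m" and Y :: "real^'d^'n"
  where "X ** transpose Y = Z" "nnzc X \<le> rank Z" "nnzc Y \<le> rank Z"
    "X \<in> Omega (spectral_norm Z / c)" "Y \<in> Omega c"
proof -
  obtain I :: "'d set" and h :: "'d \<Rightarrow> real^'n"
    where I: "card I = rank Z" and h0: "\<And>k. k \<notin> I \<Longrightarrow> h k = 0"
      and h1: "\<And>k. norm (h k) \<le> 1"
      and expand: "\<And>i. (\<Sum>k\<in>UNIV. (Z $ i \<bullet> h k) *\<^sub>R h k) = Z $ i"
    using row_space_padded_orthonormal_basis[OF assms(1)] by metis
  define X :: "real^'d^'m" where "X = (\<chi> i k. (Z *v h k) $ i / c)"
  define Y :: "real^'d^'n" where "Y = (\<chi> j k. c * h k $ j)"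
  have colX: "column k X = (1 / c) *\<^sub>R (Z *v h k)" for k
    by (simp add: X_def column_def vec_eq_iff)
  have colY: "column k Y = c *\<^sub>R h k" for k
    by (simp add: Y_def column_def vec_eq_iff)
  have "(X ** transpose Y) $ i $ j = Z $ i $ j" for i j
  proof -
    have "(X ** transpose Y) $ i $ j = (\<Sum>k\<in>UNIV. (Z $ i \<bullet> h k) *\<^sub>R h k) $ j"
      using \<open>c > 0\<close>
      by (simp add: matrix_matrix_mult_def transpose_def X_def Y_def matrix_vector_mul_component)
    then show ?thesis
      by (simp only: expand)
  qed
  then have "X ** transpose Y = Z"
    by (simp add: vec_eq_iff)
  moreover have "nnzc X \<le> rank Z"
  proof -
    have "column k X = 0" if "k \<notin> I" for k
      using h0[OF that] by (simp add: colX)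
    then show ?thesis
      unfolding nnzc_def I[symmetric] by (intro card_mono) auto
  qed
  moreover have "nnzc Y \<le> rank Z"
  proof -
    have "column k Y = 0" if "k \<notin> I" for k
      using h0[OF that] by (simp add: colY)
    then show ?thesis
      unfolding nnzc_def I[symmetric] by (intro card_mono) auto
  qed
  moreover have "X \<in> Omega (spectral_norm Z / c)"
  proof -
    have "0 \<le> spectral_norm Z"
      unfolding spectral_norm_def by (rule onorm_pos_le[OF matrix_vector_mul_bounded_linear])
    then have "norm (Z *v h k) \<le> spectral_norm Z" for k
      using norm_matrix_vector_mult_le_spectral_norm[of Z "h k"] h1[of k]
      by (meson mult_left_le order_trans)
    then show ?thesis
      using \<open>c > 0\<close> by (simp add: Omega_def colX divide_right_mono)
  qed
  moreover have "Y \<in> Omega c"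
    using \<open>c > 0\<close> h1 by (simp add: Omega_def colY mult_left_le)
  ultimately show thesis
    by (rule that)
qed

section \<open>The rank problem and its factorized forms\<close>

theorem proposition4:
  fixes f :: "real^'n^'m \<Rightarrow> real" and lam \<sigma> :: real
  assumes "CARD('n) \<le> CARD('m)"
    and "lam > 0" and "\<sigma> > 0"
    and "locally_lipschitz f"
  shows "factor_prod ` (G_U f lam :: ((real^'d^'m) \<times> (real^'d^'n)) set) = G_R f lam CARD('d)
    \<and> (\<forall>Z \<in> G_R_star f lam \<sigma> CARD('d).
          \<exists>X Y. (X, Y) \<in> (G_U f lam :: ((real^'d^'m) \<times> (real^'d^'n)) set)
            \<and> X ** transpose Y = Z \<and> (X, Y) \<in> Omega \<sigma> \<times> Omega \<sigma>)
    \<and> (G_R_star f lam \<sigma> CARD('d) \<noteq> {} \<longrightarrow>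
          (G_B f lam \<sigma> :: ((real^'d^'m) \<times> (real^'d^'n)) set) \<subseteq> G_U f lam
        \<and> G_R_star f lam \<sigma> CARD('d) \<subseteq> factor_prod ` (G_B f lam \<sigma> :: ((real^'d^'m) \<times> (real^'d^'n)) set)
        \<and> factor_prod ` (G_B f lam \<sigma> :: ((real^'d^'m) \<times> (real^'d^'n)) set) \<subseteq> G_R f lam CARD('d)
        \<and> (G_R_star f lam \<sigma> CARD('d) = G_R f lam CARD('d) \<longrightarrow>
            factor_prod ` (G_B f lam \<sigma> :: ((real^'d^'m) \<times> (real^'d^'n)) set) = G_R f lam CARD('d)))"
proof -
  \<comment> \<open>Doubling the rank objective leaves its minimizers unchanged and makes it the lower bound of
    \<open>F0\<close>, each factor contributing the rank once.\<close>
  define g where "g Z = f Z + 2 * lam * real (rank Z)" for Z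
  let ?S = "{Z :: real^'n^'m. rank Z \<le> CARD('d)}"
  let ?p = "factor_prod :: (real^'d^'m) \<times> (real^'d^'n) \<Rightarrow> real^'n^'m"
  let ?U = "G_U f lam :: ((real^'d^'m) \<times> (real^'d^'n)) set"
  let ?B = "G_B f lam \<sigma> :: ((real^'d^'m) \<times> (real^'d^'n)) set"
  let ?O = "Omega \<sigma> \<times> Omega \<sigma> :: ((real^'d^'m) \<times> (real^'d^'n)) set"
  have G_R: "G_R f lam CARD('d) = global_minimizers ?S g"
  proof -
    have "1/2 * f Z + lam * real (rank Z) \<le> 1/2 * f W + lam * real (rank W) \<longleftrightarrow> g Z \<le> g W" for Z W
      unfolding g_def by linarith
    then show ?thesis
      by (simp add: set_eq_iff G_R_def mem_global_minimizers_iff)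
  qed
  have maps: "range ?p \<subseteq> ?S"
    by (auto simp: factor_prod_def intro: order_trans[OF rank_factor_prod_le_nnzc(1) nnzc_le_CARD])
  have lower: "g (?p P) \<le> F0 f lam P" for P
  proof -
    obtain X Y where P: "P = (X, Y)"
      by fastforce
    have "2 * real (rank (X ** transpose Y)) \<le> real (nnzc X) + real (nnzc Y)"
      using rank_factor_prod_le_nnzc[of X Y] by linarith
    then have "lam * (2 * real (rank (X ** transpose Y))) \<le> lam * (real (nnzc X) + real (nnzc Y))"
      using \<open>lam > 0\<close> by (intro mult_left_mono) auto
    then show ?thesis
      by (simp add: P g_def F0_def factor_prod_def)
  qed
  have attained: "\<exists>P. ?p P = Z \<and> F0 f lam P \<le> g Z \<and> (spectral_norm Z \<le> \<sigma>\<^sup>2 \<longrightarrow> P \<in> ?O)"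
    if Z: "Z \<in> ?S" for Z
  proof -
    obtain X :: "real^'d^'m" and Y :: "real^'d^'n"
      where XY: "X ** transpose Y = Z" "nnzc X \<le> rank Z" "nnzc Y \<le> rank Z"
        "X \<in> Omega (spectral_norm Z / \<sigma>)" "Y \<in> Omega \<sigma>"
      using rank_factorization Z \<open>\<sigma> > 0\<close> unfolding mem_Collect_eq by metis
    have "lam * (real (nnzc X) + real (nnzc Y)) \<le> lam * (2 * real (rank Z))"
      using XY(2,3) \<open>lam > 0\<close> by (intro mult_left_mono) auto
    then have "F0 f lam (X, Y) \<le> g Z"
      using XY(1) by (simp add: g_def F0_def)
    moreover have "X \<in> Omega \<sigma>" if "spectral_norm Z \<le> \<sigma>\<^sup>2"
    proof -
      have "spectral_norm Z / \<sigma> \<le> \<sigma>"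
        using that \<open>\<sigma> > 0\<close> by (simp add: divide_le_eq power2_eq_square)
      then show ?thesis
        using XY(4) by (auto simp: Omega_def intro: order_trans)
    qed
    ultimately show ?thesis
      using XY(1,5) by (intro exI[of _ "(X, Y)"]) (simp add: factor_prod_def)
  qed
  have i: "?p ` ?U = G_R f lam CARD('d)"
    unfolding G_U_def G_R
  proof (rule image_global_minimizers_lift[OF maps])
    show "\<exists>P\<in>UNIV. ?p P = Z \<and> F0 f lam P \<le> g Z" if "Z \<in> ?S" for Z
      using attained[OF that] by blast
  qed (rule lower)
  have ii: "\<exists>P \<in> ?U \<inter> ?O. ?p P = Z" if "Z \<in> G_R_star f lam \<sigma> CARD('d)" for Z
  proof -
    have Z: "Z \<in> global_minimizers ?S g" "spectral_norm Z \<le> \<sigma>\<^sup>2"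
      using that by (auto simp: G_R_star_def G_R)
    then obtain P where P: "?p P = Z" "F0 f lam P \<le> g Z" "P \<in> ?O"
      using attained[of Z] unfolding mem_global_minimizers_iff by blast
    have "P \<in> ?U"
      unfolding G_U_def
      by (rule global_minimizers_lift_fibre[OF maps]) (use lower P Z(1) in simp_all)
    then show ?thesis
      using P by blast
  qed
  have B: "?B = ?U \<inter> ?O" if "G_R_star f lam \<sigma> CARD('d) \<noteq> {}"
    unfolding G_B_def G_U_def
  proof (rule global_minimizers_restrict)
    show "global_minimizers UNIV (F0 f lam) \<inter> ?O \<noteq> {}"
      using ii that unfolding G_U_def by blast
  qed simp
  have iii: "G_R_star f lam \<sigma> CARD('d) \<subseteq> ?p ` ?B \<and> ?p ` ?B \<subseteq> G_R f lam CARD('d) \<and> ?B \<subseteq> ?U"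
    if "G_R_star f lam \<sigma> CARD('d) \<noteq> {}"
    unfolding B[OF that] using i ii by blast
  have ii': "\<exists>X Y. (X, Y) \<in> ?U \<and> X ** transpose Y = Z \<and> (X, Y) \<in> ?O"
    if "Z \<in> G_R_star f lam \<sigma> CARD('d)" for Z
    using ii[OF that] by (force simp: factor_prod_def)
  show ?thesis
    using i ii' iii by blast
qed

end
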